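(* Let $R$ be a unital full subring of the disk algebra $A(\mathbb D)$, let $S:=C(\mathbb T)$ with the involution $f^*(z)=\overline{f(z)}$ ($z\in\mathbb T$), let $G:=\mathbb Z$, and let $\iota:=\mathtt{w}:\mathrm{inv}\,C(\mathbb T)\to\mathbb Z$ be the winding number. Then the following hold: (A1) $R$ is a commutative integral domain with identity. (A2) $S$ is a unital commutative complex semisimple Banach algebra with involution $\cdot^*$, and $R\subset S$ (identifying $f\in A(\mathbb D)$ with its restriction $f|_{\mathbb T}$). (A3) (I1) $\iota(ab)=\iota(a)+\iota(b)$ for all $a,b\in\mathrm{inv}\,S$; (I2) $\iota(a^* )=-\iota(a)$ for all $a\in\mathrm{inv}\,S$; (I3) $\iota$ is locally constant, i.e. continuous when $G$ is given the discrete topology. (A4) An element $x\in R\cap\mathrm{inv}\,S$ is invertible as an element of $R$ if and only if $\iota(x)=0$.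
   Context: $\mathbb D$ is the open unit disk in $\mathbb C$, $\mathbb T$ the unit circle. $A(\mathbb D)$ is the set of functions $\overline{\mathbb D}\to\mathbb C$ continuous on $\overline{\mathbb D}$ and holomorphic in $\mathbb D$. $C(\mathbb T)$ is the algebra of continuous complex functions on $\mathbb T$ with the sup norm. $\mathrm{inv}\,S$ is the set of invertible elements of $S$. For $f\in\mathrm{inv}\,C(\mathbb T)$, the winding number is $\mathtt w(f)=\frac1{2\pi}(\Theta(2\pi)-\Theta(0))$, where $\Theta:[0,2\pi]\to\mathbb R$ is continuous with $f(e^{it})=|f(e^{it})|e^{i\Theta(t)}$ for $t\in[0,2\pi]$. A subring $R_1$ of a commutative unital ring $R_2$ is full if every $x\in R_1$ that is invertible in $R_2$ is invertible in $R_1$. *)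

theory Defs
  imports "HOL-Analysis.Analysis" "HOL-Algebra.Algebraic_Closure_Type"
begin

text \<open>Functions on the closed disk and on the circle are represented as extensional functions
  (equal to \<open>undefined\<close> off their domain), so that equality of carrier elements is equality
  of functions.\<close>

definition disk_algebra :: "(complex \<Rightarrow> complex) ring" where
  "disk_algebra = \<lparr>
     carrier = {f \<in> extensional (cball 0 1).
                  continuous_on (cball 0 1) f \<and> f holomorphic_on ball 0 1},
     monoid.mult = (\<lambda>f g. \<lambda>z\<in>cball 0 1. f z * g z),
     monoid.one = (\<lambda>z\<in>cball 0 1. 1),
     ring.zero = (\<lambda>z\<in>cball 0 1. 0),
     ring.add = (\<lambda>f g. \<lambda>z\<in>cball 0 1. f z + g z)\<rparr>"

definition circle_algebra :: "(complex, complex \<Rightarrow> complex) module" where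
  "circle_algebra = \<lparr>
     carrier = {f \<in> extensional (sphere 0 1). continuous_on (sphere 0 1) f},
     monoid.mult = (\<lambda>f g. \<lambda>z\<in>sphere 0 1. f z * g z),
     monoid.one = (\<lambda>z\<in>sphere 0 1. 1),
     ring.zero = (\<lambda>z\<in>sphere 0 1. 0),
     ring.add = (\<lambda>f g. \<lambda>z\<in>sphere 0 1. f z + g z),
     module.smult = (\<lambda>c f. \<lambda>z\<in>sphere 0 1. c * f z)\<rparr>"

definition circle_norm :: "(complex \<Rightarrow> complex) \<Rightarrow> real" where
  "circle_norm f = (SUP z\<in>sphere 0 1. cmod (f z))"

definition circle_star :: "(complex \<Rightarrow> complex) \<Rightarrow> complex \<Rightarrow> complex" where
  "circle_star f = (\<lambda>z\<in>sphere 0 1. cnj (f z))"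

abbreviation to_circle :: "(complex \<Rightarrow> complex) \<Rightarrow> complex \<Rightarrow> complex" where
  "to_circle f \<equiv> restrict f (sphere 0 1)"

text \<open>The locale \<^locale>\<open>subring\<close> already requires the subring to contain \<open>\<one>\<close>.\<close>

definition full_subring :: "'a set \<Rightarrow> ('a, 'm) ring_scheme \<Rightarrow> bool" where
  "full_subring H A \<longleftrightarrow> subring H A \<and> (\<forall>x\<in>H. x \<in> Units A \<longrightarrow> x \<in> Units (A\<lparr>carrier := H\<rparr>))"

text \<open>The case distinction is there because \<^locale>\<open>Metric_space\<close> demands nonnegativity and
  symmetry of the distance on the whole type, not just on the carrier.\<close>

definition norm_dist :: "('a, 'm) ring_scheme \<Rightarrow> ('a \<Rightarrow> real) \<Rightarrow> 'a \<Rightarrow> 'a \<Rightarrow> real" where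
  "norm_dist A nrm x y =
     (if x \<in> carrier A \<and> y \<in> carrier A then nrm (x \<ominus>\<^bsub>A\<^esub> y) else 0)"

abbreviation norm_topology :: "('a, 'm) ring_scheme \<Rightarrow> ('a \<Rightarrow> real) \<Rightarrow> 'a topology" where
  "norm_topology A nrm \<equiv> Metric_space.mtopology (carrier A) (norm_dist A nrm)"

text \<open>Unital commutative complex Banach algebras; the parent locale \<^locale>\<open>Module.algebra\<close>
  includes \<^locale>\<open>cring\<close>, hence commutativity and the identity.\<close>

locale comm_banach_algebra = Module.algebra "ring_of_type_algebra :: complex ring" A
  for A :: "(complex, 'a) module" (structure) +
  fixes nrm :: "'a \<Rightarrow> real"
  assumes nrm_nonneg: "x \<in> carrier A \<Longrightarrow> 0 \<le> nrm x"
    and nrm_eq_0: "x \<in> carrier A \<Longrightarrow> nrm x = 0 \<longleftrightarrow> x = \<zero>"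
    and nrm_triangle: "\<lbrakk>x \<in> carrier A; y \<in> carrier A\<rbrakk> \<Longrightarrow> nrm (x \<oplus> y) \<le> nrm x + nrm y"
    and nrm_smult: "x \<in> carrier A \<Longrightarrow> nrm (c \<odot>\<^bsub>A\<^esub> x) = cmod c * nrm x"
    and nrm_mult: "\<lbrakk>x \<in> carrier A; y \<in> carrier A\<rbrakk> \<Longrightarrow> nrm (x \<otimes> y) \<le> nrm x * nrm y"
    and nrm_one: "nrm \<one> = 1"
    and complete: "Metric_space.mcomplete (carrier A) (norm_dist A nrm)"

locale comm_banach_algebra_involution = comm_banach_algebra +
  fixes star :: "'a \<Rightarrow> 'a"
  assumes star_closed: "x \<in> carrier A \<Longrightarrow> star x \<in> carrier A"
    and star_star: "x \<in> carrier A \<Longrightarrow> star (star x) = x"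
    and star_add: "\<lbrakk>x \<in> carrier A; y \<in> carrier A\<rbrakk> \<Longrightarrow> star (x \<oplus> y) = star x \<oplus> star y"
    and star_smult: "x \<in> carrier A \<Longrightarrow> star (c \<odot>\<^bsub>A\<^esub> x) = cnj c \<odot>\<^bsub>A\<^esub> star x"
    and star_mult: "\<lbrakk>x \<in> carrier A; y \<in> carrier A\<rbrakk> \<Longrightarrow> star (x \<otimes> y) = star y \<otimes> star x"

text \<open>For a commutative unital ring the Jacobson radical is the intersection of the maximal
  ideals; in a unital algebra every ring ideal is an algebra ideal.\<close>

definition jacobson_radical :: "('a, 'm) ring_scheme \<Rightarrow> 'a set" where
  "jacobson_radical A = {x \<in> carrier A. \<forall>M. maximalideal M A \<longrightarrow> x \<in> M}"

definition semisimple :: "('a, 'm) ring_scheme \<Rightarrow> bool" where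
  "semisimple A \<longleftrightarrow> jacobson_radical A = {\<zero>\<^bsub>A\<^esub>}"

definition continuous_argument :: "(complex \<Rightarrow> complex) \<Rightarrow> (real \<Rightarrow> real) \<Rightarrow> bool" where
  "continuous_argument f \<Theta> \<longleftrightarrow> continuous_on {0..2 * pi} \<Theta> \<and>
     (\<forall>t\<in>{0..2 * pi}. f (cis t) = complex_of_real (cmod (f (cis t))) * cis (\<Theta> t))"

text \<open>The winding number as an integer; that it is well defined on the invertible elements of
  \<^const>\<open>circle_algebra\<close> is shown in \<open>continuous_argument_exists\<close> and \<open>circle_winding_eq\<close>.\<close>

definition circle_winding :: "(complex \<Rightarrow> complex) \<Rightarrow> int" where
  "circle_winding f =
     (THE n. \<exists>\<Theta>. continuous_argument f \<Theta> \<and>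
        real_of_int n = 1 / (2 * pi) * (\<Theta> (2 * pi) - \<Theta> 0))"

lemma Units_circle_algebraD:
  assumes "f \<in> Units circle_algebra"
  shows "continuous_on (sphere 0 1) f" "z \<in> sphere 0 1 \<Longrightarrow> f z \<noteq> 0"
proof -
  show "continuous_on (sphere 0 1) f"
    using assms by (auto simp: Units_def circle_algebra_def)
  obtain g where g: "(\<lambda>z\<in>sphere 0 1. g z * f z) = (\<lambda>z\<in>sphere 0 1. 1)"
    using assms by (auto simp: Units_def circle_algebra_def)
  show "f z \<noteq> 0" if "z \<in> sphere 0 1"
    using fun_cong[OF g, of z] that by auto
qed

lemma continuous_argument_exists:
  assumes "f \<in> Units circle_algebra"
  shows "\<exists>\<Theta>. continuous_argument f \<Theta>"
proof -
  have cont: "continuous_on {0..2 * pi} (\<lambda>t. f (cis t))"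
    by (rule continuous_on_compose2[OF Units_circle_algebraD(1)[OF assms]])
       (auto intro!: continuous_intros)
  have nz: "f (cis t) \<noteq> 0" for t
    by (rule Units_circle_algebraD(2)[OF assms]) auto
  obtain h where h: "continuous_on {0..2 * pi} h" "\<And>t. t \<in> {0..2 * pi} \<Longrightarrow> f (cis t) = exp (h t)"
    using continuous_logarithm_on_contractible[OF cont convex_imp_contractible] nz
    by (metis convex_real_interval(5))
  have "continuous_argument f (\<lambda>t. Im (h t))"
    unfolding continuous_argument_def
  proof (intro conjI ballI)
    show "continuous_on {0..2 * pi} (\<lambda>t. Im (h t))"
      by (intro continuous_intros h)
    show "f (cis t) = complex_of_real (cmod (f (cis t))) * cis (Im (h t))" if "t \<in> {0..2 * pi}" for t
      using h(2)[OF that] by (simp add: exp_eq_polar norm_mult)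
  qed
  then show ?thesis by blast
qed

lemma continuous_argument_cong_mod:
  assumes "f \<in> Units circle_algebra" "continuous_argument f \<Theta>" "continuous_argument f \<Phi>"
    and "s \<in> {0..2 * pi}" "t \<in> {0..2 * pi}" "cis s = cis t"
  shows "\<exists>n::int. \<Theta> s - \<Phi> t = 2 * pi * n"
proof -
  have "f (cis t) \<noteq> 0"
    by (rule Units_circle_algebraD(2)[OF assms(1)]) auto
  moreover have "f (cis t) = complex_of_real (cmod (f (cis t))) * cis (\<Theta> s)"
    using assms unfolding continuous_argument_def by metis
  moreover have "f (cis t) = complex_of_real (cmod (f (cis t))) * cis (\<Phi> t)"
    using assms unfolding continuous_argument_def by metis
  ultimately have "cis (\<Theta> s) = cis (\<Phi> t)"
    by (metis mult_cancel_left mult_eq_0_iff)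
  then have "cis (\<Theta> s - \<Phi> t) = 1"
    by (simp flip: cis_divide)
  then have "cos (\<Theta> s - \<Phi> t) = 1"
    by (metis cis.sel(1) one_complex.sel(1))
  then show ?thesis
    by (auto simp: cos_one_2pi_int mult_ac)
qed

lemma circle_winding_eq:
  assumes f: "f \<in> Units circle_algebra" and \<Theta>: "continuous_argument f \<Theta>"
  shows "real_of_int (circle_winding f) = 1 / (2 * pi) * (\<Theta> (2 * pi) - \<Theta> 0)"
proof -
  obtain n :: int where n: "\<Theta> (2 * pi) - \<Theta> 0 = 2 * pi * n"
    using continuous_argument_cong_mod[OF f \<Theta> \<Theta>, of "2 * pi" 0] by auto
  have same: "\<Phi> (2 * pi) - \<Phi> 0 = \<Theta> (2 * pi) - \<Theta> 0" if \<Phi>: "continuous_argument f \<Phi>" for \<Phi>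
  proof -
    define d where "d = (\<lambda>t. (\<Phi> t - \<Theta> t) / (2 * pi))"
    have "continuous_on {0..2 * pi} d"
      using \<Theta> \<Phi> unfolding d_def continuous_argument_def by (auto intro!: continuous_intros)
    moreover have "d t \<in> \<int>" if "t \<in> {0..2 * pi}" for t
      using continuous_argument_cong_mod[OF f \<Phi> \<Theta> that that] by (auto simp: d_def)
    then have "d ` {0..2 * pi} \<subseteq> \<int>" by auto
    ultimately have "d constant_on {0..2 * pi}"
      by (intro continuous_discrete_range_constant)
         (auto, metis Ints_diff Ints_nonzero_abs_ge1 eq_iff_diff_eq_0 image_subset_iff less_numeral_extra(1)
           atLeastAtMost_iff)
    then have "d (2 * pi) = d 0"
      unfolding constant_on_def by force
    then show ?thesis by (simp add: d_def field_simps)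
  qed
  have "circle_winding f = n"
    unfolding circle_winding_def
  proof (rule the_equality)
    show "\<exists>\<Theta>. continuous_argument f \<Theta> \<and> real_of_int n = 1 / (2 * pi) * (\<Theta> (2 * pi) - \<Theta> 0)"
      using \<Theta> n by (auto intro!: exI[of _ \<Theta>])
    show "m = n" if "\<exists>\<Theta>. continuous_argument f \<Theta> \<and>
        real_of_int m = 1 / (2 * pi) * (\<Theta> (2 * pi) - \<Theta> 0)" for m
      using that same n by auto
  qed
  then show ?thesis using n by simp
qed

end

theory Submission
  imports Defs "HOL-Complex_Analysis.Complex_Analysis"
begin

text \<open>The substance of the theorem is that a function \<open>f\<close> in the disk algebra which has a zero
  \<open>a\<close> in the open disk, but none on the circle, has positive winding number. The winding number is
  multiplicative and does not change under perturbations smaller than \<open>\<bar>f\<bar>\<close> on the circle. As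
  polynomials are uniformly dense in the disk algebra, some polynomial \<open>p\<close> is so close to \<open>f\<close>
  that \<open>p - p(a)\<close> has the same winding number as \<open>f\<close>. That polynomial vanishes at \<open>a\<close>, and by
  factorization into linear factors the winding number of a polynomial without zeros on the circle
  is the number of its zeros in the disk. This avoids dividing the zeros out of \<open>f\<close> itself.
  Conversely, a function without zeros on the closed disk has a continuous logarithm there,
  so its winding number is \<open>0\<close>.\<close>

section \<open>The disk algebra\<close>

lemma disk_algebra_simps:
  "f \<in> carrier disk_algebra \<longleftrightarrow>
     f \<in> extensional (cball 0 1) \<and> continuous_on (cball 0 1) f \<and> f holomorphic_on ball 0 1"
  "f \<otimes>\<^bsub>disk_algebra\<^esub> g = (\<lambda>z\<in>cball 0 1. f z * g z)"
  "\<one>\<^bsub>disk_algebra\<^esub> = (\<lambda>z\<in>cball 0 1. 1)"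
  "\<zero>\<^bsub>disk_algebra\<^esub> = (\<lambda>z\<in>cball 0 1. 0)"
  "f \<oplus>\<^bsub>disk_algebra\<^esub> g = (\<lambda>z\<in>cball 0 1. f z + g z)"
  by (auto simp: disk_algebra_def)

text \<open>The ring operations produce restricted functions; since membership depends only on
  values on the closed disk, closure under them reduces to continuity and holomorphy of the
  unrestricted expression.\<close>

lemma restrict_in_disk_algebra:
  assumes "continuous_on (cball 0 1) f" "f holomorphic_on ball 0 1"
  shows "restrict f (cball 0 1) \<in> carrier disk_algebra"
proof -
  have "continuous_on (cball 0 1) (restrict f (cball 0 1)) \<longleftrightarrow> continuous_on (cball 0 1) f"
    by (rule continuous_on_cong) auto
  moreover have "restrict f (cball 0 1) holomorphic_on ball 0 1 \<longleftrightarrow> f holomorphic_on ball 0 1"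
    by (rule holomorphic_cong) auto
  ultimately show ?thesis
    using assms unfolding disk_algebra_simps(1) by blast
qed

lemma disk_algebraD:
  assumes "f \<in> carrier disk_algebra"
  shows "f \<in> extensional (cball 0 1)" "continuous_on (cball 0 1) f" "f holomorphic_on ball 0 1"
  using assms by (simp_all add: disk_algebra_simps)

lemma cring_disk_algebra: "cring disk_algebra"
proof (rule cringI)
  show "abelian_group disk_algebra"
  proof (rule abelian_groupI)
    show "\<exists>y\<in>carrier disk_algebra. y \<oplus>\<^bsub>disk_algebra\<^esub> f = \<zero>\<^bsub>disk_algebra\<^esub>"
      if "f \<in> carrier disk_algebra" for f
    proof (rule bexI)
      show "(\<lambda>z\<in>cball 0 1. - f z) \<in> carrier disk_algebra"
        by (intro restrict_in_disk_algebra continuous_intros holomorphic_intros disk_algebraD that)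
    qed (auto simp: disk_algebra_simps)
  next
    show "f \<oplus>\<^bsub>disk_algebra\<^esub> g \<in> carrier disk_algebra"
      if "f \<in> carrier disk_algebra" "g \<in> carrier disk_algebra" for f g
      unfolding disk_algebra_simps(5)
      by (intro restrict_in_disk_algebra continuous_intros holomorphic_intros disk_algebraD that)
    show "\<zero>\<^bsub>disk_algebra\<^esub> \<in> carrier disk_algebra"
      unfolding disk_algebra_simps(4) by (intro restrict_in_disk_algebra continuous_intros holomorphic_intros)
  qed (auto simp: disk_algebra_simps extensional_def fun_eq_iff add_ac)
  show "comm_monoid disk_algebra"
  proof (rule comm_monoidI)
    show "f \<otimes>\<^bsub>disk_algebra\<^esub> g \<in> carrier disk_algebra"
      if "f \<in> carrier disk_algebra" "g \<in> carrier disk_algebra" for f g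
      unfolding disk_algebra_simps(2)
      by (intro restrict_in_disk_algebra continuous_intros holomorphic_intros disk_algebraD that)
    show "\<one>\<^bsub>disk_algebra\<^esub> \<in> carrier disk_algebra"
      unfolding disk_algebra_simps(3) by (intro restrict_in_disk_algebra continuous_intros holomorphic_intros)
  qed (auto simp: disk_algebra_simps extensional_def fun_eq_iff mult_ac)
qed (auto simp: disk_algebra_simps distrib_right)

text \<open>The open disk is dense in the closed one, so continuity carries zeros to the boundary.
  This lets identity arguments take place in the open disk, where functions are holomorphic.\<close>

lemma disk_algebra_eq_0I:
  assumes f: "f \<in> carrier disk_algebra" and 0: "\<And>z. z \<in> ball 0 1 \<Longrightarrow> f z = 0"
  shows "f = \<zero>\<^bsub>disk_algebra\<^esub>"
proof (rule extensionalityI[of _ "cball 0 1"])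
  fix z :: complex assume "z \<in> cball 0 1"
  then have z: "z \<in> closure (ball 0 1)" by simp
  have "continuous_on (closure (ball 0 1)) f"
    using disk_algebraD(2)[OF f] by simp
  then have "f z = 0"
    using continuous_constant_on_closure 0 z by blast
  then show "f z = \<zero>\<^bsub>disk_algebra\<^esub> z"
    using z by (simp add: disk_algebra_simps)
qed (use f in \<open>auto simp: disk_algebra_simps\<close>)

text \<open>Identity theorem: if \<open>g\<close> is not zero, it is nonzero on a nonempty open set;
  there the other factor \<open>f\<close> must vanish, hence it vanishes on the whole connected
  disk.\<close>

lemma domain_disk_algebra: "domain disk_algebra"
proof -
  interpret cring disk_algebra by (rule cring_disk_algebra)
  show ?thesis
  proof
    show "\<one>\<^bsub>disk_algebra\<^esub> \<noteq> \<zero>\<^bsub>disk_algebra\<^esub>"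
      by (auto simp: disk_algebra_simps fun_eq_iff intro!: exI[of _ 0])
    fix f g
    assume fg: "f \<otimes>\<^bsub>disk_algebra\<^esub> g = \<zero>\<^bsub>disk_algebra\<^esub>"
      and f: "f \<in> carrier disk_algebra" and g: "g \<in> carrier disk_algebra"
    have prod: "f z * g z = 0" if "z \<in> cball 0 1" for z
      using fun_cong[OF fg, of z] that by (simp add: disk_algebra_simps)
    show "f = \<zero>\<^bsub>disk_algebra\<^esub> \<or> g = \<zero>\<^bsub>disk_algebra\<^esub>"
    proof (rule disjCI)
      assume "g \<noteq> \<zero>\<^bsub>disk_algebra\<^esub>"
      then obtain w where w: "w \<in> ball 0 1" "g w \<noteq> 0"
        using disk_algebra_eq_0I[OF g] by blast
      define U where "U = {z \<in> ball 0 1. g z \<in> - {0}}"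
      have "continuous_on (ball 0 1) g"
        using disk_algebraD(3)[OF g] by (rule holomorphic_on_imp_continuous_on)
      then have "open (ball 0 1 \<inter> g -` (- {0}))"
        by (rule continuous_open_preimage) auto
      also have "ball 0 1 \<inter> g -` (- {0}) = U"
        by (auto simp: U_def)
      finally have "open U" .
      have "f z = 0" if "z \<in> ball 0 1" for z
      proof (rule analytic_continuation_open[of U "ball 0 1" f "\<lambda>_. 0"])
        show "f z = 0" if "z \<in> U" for z
          using prod[of z] that by (auto simp: U_def)
      qed (use \<open>open U\<close> w f that in \<open>auto simp: U_def disk_algebra_simps\<close>)
      then show "f = \<zero>\<^bsub>disk_algebra\<^esub>"
        using disk_algebra_eq_0I[OF f] by blast
    qed
  qed
qed

text \<open>Without zeros on the closed disk, the pointwise inverse is again continuous there and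
  holomorphic inside; conversely, evaluating an inverse relation at a point excludes a zero.\<close>

lemma Units_disk_algebra:
  "f \<in> Units disk_algebra \<longleftrightarrow>
     f \<in> carrier disk_algebra \<and> (\<forall>z\<in>cball 0 1. f z \<noteq> 0)"
proof (intro iffI conjI ballI)
  fix z :: complex
  assume f: "f \<in> Units disk_algebra" and z: "z \<in> cball 0 1"
  then obtain g where "g \<otimes>\<^bsub>disk_algebra\<^esub> f = \<one>\<^bsub>disk_algebra\<^esub>"
    by (auto simp: Units_def)
  from fun_cong[OF this, of z] z show "f z \<noteq> 0"
    by (auto simp: disk_algebra_simps)
next
  assume f: "f \<in> carrier disk_algebra \<and> (\<forall>z\<in>cball 0 1. f z \<noteq> 0)"
  then have "(\<lambda>z\<in>cball 0 1. inverse (f z)) \<in> carrier disk_algebra"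
    by (intro restrict_in_disk_algebra continuous_intros holomorphic_intros disk_algebraD) auto
  with f show "f \<in> Units disk_algebra"
    unfolding Units_def
    by (auto intro!: bexI[of _ "\<lambda>z\<in>cball 0 1. inverse (f z)"] simp: disk_algebra_simps(2,3) fun_eq_iff)
qed (simp add: Units_def)

section \<open>Continuous functions on the circle\<close>

lemma circle_algebra_simps:
  "f \<in> carrier circle_algebra \<longleftrightarrow>
     f \<in> extensional (sphere 0 1) \<and> continuous_on (sphere 0 1) f"
  "f \<otimes>\<^bsub>circle_algebra\<^esub> g = (\<lambda>z\<in>sphere 0 1. f z * g z)"
  "\<one>\<^bsub>circle_algebra\<^esub> = (\<lambda>z\<in>sphere 0 1. 1)"
  "\<zero>\<^bsub>circle_algebra\<^esub> = (\<lambda>z\<in>sphere 0 1. 0)"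
  "f \<oplus>\<^bsub>circle_algebra\<^esub> g = (\<lambda>z\<in>sphere 0 1. f z + g z)"
  "c \<odot>\<^bsub>circle_algebra\<^esub> f = (\<lambda>z\<in>sphere 0 1. c * f z)"
  by (auto simp: circle_algebra_def)

lemma to_circle_in_circle_algebra:
  "to_circle f \<in> carrier circle_algebra \<longleftrightarrow> continuous_on (sphere 0 1) f"
proof -
  have "continuous_on (sphere 0 1) (to_circle f) \<longleftrightarrow> continuous_on (sphere 0 1) f"
    by (rule continuous_on_cong) auto
  then show ?thesis
    unfolding circle_algebra_simps(1) by blast
qed

lemmas to_circleI = to_circle_in_circle_algebra[THEN iffD2]

lemma circle_algebraD:
  assumes "f \<in> carrier circle_algebra"
  shows "f \<in> extensional (sphere 0 1)" "continuous_on (sphere 0 1) f"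
  using assms by (simp_all add: circle_algebra_simps)

lemma Units_circle_algebra:
  "f \<in> Units circle_algebra \<longleftrightarrow>
     f \<in> carrier circle_algebra \<and> (\<forall>z\<in>sphere 0 1. f z \<noteq> 0)"
proof
  assume "f \<in> Units circle_algebra"
  then show "f \<in> carrier circle_algebra \<and> (\<forall>z\<in>sphere 0 1. f z \<noteq> 0)"
    using Units_circle_algebraD(2)[of f] by (auto simp: Units_def)
next
  assume f: "f \<in> carrier circle_algebra \<and> (\<forall>z\<in>sphere 0 1. f z \<noteq> 0)"
  then have "to_circle (\<lambda>z. inverse (f z)) \<in> carrier circle_algebra"
    by (intro to_circleI continuous_intros circle_algebraD) auto
  with f show "f \<in> Units circle_algebra"
    unfolding Units_def
    by (auto intro!: bexI[of _ "to_circle (\<lambda>z. inverse (f z))"] simp: circle_algebra_simps(2,3) fun_eq_iff)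
qed

lemma to_circle_Units:
  "to_circle f \<in> Units circle_algebra \<longleftrightarrow>
     continuous_on (sphere 0 1) f \<and> (\<forall>z\<in>sphere 0 1. f z \<noteq> 0)"
  by (simp add: Units_circle_algebra to_circle_in_circle_algebra)

lemma cring_circle_algebra: "cring circle_algebra"
proof (rule cringI)
  show "abelian_group circle_algebra"
  proof (rule abelian_groupI)
    show "\<exists>y\<in>carrier circle_algebra. y \<oplus>\<^bsub>circle_algebra\<^esub> f = \<zero>\<^bsub>circle_algebra\<^esub>"
      if "f \<in> carrier circle_algebra" for f
    proof (rule bexI)
      show "to_circle (\<lambda>z. - f z) \<in> carrier circle_algebra"
        by (intro to_circleI continuous_intros circle_algebraD that)
    qed (auto simp: circle_algebra_simps)
  next
    show "f \<oplus>\<^bsub>circle_algebra\<^esub> g \<in> carrier circle_algebra"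
      if "f \<in> carrier circle_algebra" "g \<in> carrier circle_algebra" for f g
      unfolding circle_algebra_simps(5)
      by (intro to_circleI continuous_intros circle_algebraD that)
    show "\<zero>\<^bsub>circle_algebra\<^esub> \<in> carrier circle_algebra"
      unfolding circle_algebra_simps(4) by (intro to_circleI continuous_intros)
  qed (auto simp: circle_algebra_simps extensional_def fun_eq_iff add_ac)
  show "comm_monoid circle_algebra"
  proof (rule comm_monoidI)
    show "f \<otimes>\<^bsub>circle_algebra\<^esub> g \<in> carrier circle_algebra"
      if "f \<in> carrier circle_algebra" "g \<in> carrier circle_algebra" for f g
      unfolding circle_algebra_simps(2)
      by (intro to_circleI continuous_intros circle_algebraD that)
    show "\<one>\<^bsub>circle_algebra\<^esub> \<in> carrier circle_algebra"
      unfolding circle_algebra_simps(3) by (intro to_circleI continuous_intros)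
  qed (auto simp: circle_algebra_simps extensional_def fun_eq_iff mult_ac)
qed (auto simp: circle_algebra_simps distrib_right)

interpretation circle: cring circle_algebra
  by (rule cring_circle_algebra)

lemma algebra_circle_algebra: "Module.algebra (ring_of_type_algebra :: complex ring) circle_algebra"
proof (rule algebraI)
  show "c \<odot>\<^bsub>circle_algebra\<^esub> f \<in> carrier circle_algebra"
    if "f \<in> carrier circle_algebra" for c f
    unfolding circle_algebra_simps(6)
    by (intro to_circleI continuous_intros circle_algebraD that)
qed (auto simp: circle_algebra_simps ring_of_type_algebra_def extensional_def fun_eq_iff
       algebra_simps cring_circle_algebra cring_from_type_algebra[unfolded ring_of_type_algebra_def])

text \<open>Ring subtraction is defined through an abstract additive inverse and does not unfold to
  a pointwise formula. Writing \<open>f\<close> as the pointwise difference plus \<open>g\<close>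
  and cancelling \<open>g\<close> identifies it.\<close>

lemma circle_minus:
  assumes "f \<in> carrier circle_algebra" "g \<in> carrier circle_algebra"
  shows "f \<ominus>\<^bsub>circle_algebra\<^esub> g = to_circle (\<lambda>z. f z - g z)"
proof -
  have d: "to_circle (\<lambda>z. f z - g z) \<in> carrier circle_algebra"
    by (intro to_circleI continuous_intros circle_algebraD assms)
  have "f = to_circle (\<lambda>z. f z - g z) \<oplus>\<^bsub>circle_algebra\<^esub> g"
    using assms by (auto simp: circle_algebra_simps extensional_def fun_eq_iff)
  then have "f \<ominus>\<^bsub>circle_algebra\<^esub> g =
      to_circle (\<lambda>z. f z - g z) \<oplus>\<^bsub>circle_algebra\<^esub> g \<ominus>\<^bsub>circle_algebra\<^esub> g"
    by simp
  also have "\<dots> = to_circle (\<lambda>z. f z - g z)"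
    using assms d by (simp add: circle.minus_eq circle.a_assoc circle.r_neg)
  finally show ?thesis .
qed

section \<open>The sup norm and the complete metric it induces\<close>

lemma norm_le_circle_norm:
  assumes "f \<in> carrier circle_algebra" "z \<in> sphere 0 1"
  shows "cmod (f z) \<le> circle_norm f"
  unfolding circle_norm_def
proof (rule cSUP_upper[OF assms(2)])
  \<comment> \<open>A real supremum is an upper bound only for bounded sets; boundedness comes from
    compactness of the circle.\<close>
  have "compact ((\<lambda>z. cmod (f z)) ` sphere 0 1)"
    using assms by (intro compact_continuous_image continuous_intros) (auto simp: circle_algebra_simps)
  then show "bdd_above ((\<lambda>z. cmod (f z)) ` sphere 0 1)"
    by (simp add: bounded_imp_bdd_above compact_imp_bounded)
qed

lemma circle_norm_le:
  assumes "\<And>z. z \<in> sphere 0 1 \<Longrightarrow> cmod (f z) \<le> B"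
  shows "circle_norm f \<le> B"
  unfolding circle_norm_def using assms by (intro cSUP_least) auto

text \<open>The value at the point 1 of the circle bounds the supremum from below.\<close>

lemma circle_norm_nonneg: "f \<in> carrier circle_algebra \<Longrightarrow> 0 \<le> circle_norm f"
  using norm_le_circle_norm[of f 1] norm_ge_zero[of "f 1"] by (simp del: norm_ge_zero)

lemma circle_norm_eq_0:
  assumes "f \<in> carrier circle_algebra"
  shows "circle_norm f = 0 \<longleftrightarrow> f = \<zero>\<^bsub>circle_algebra\<^esub>"
proof
  assume "circle_norm f = 0"
  then have "f z = 0" if "z \<in> sphere 0 1" for z
    using norm_le_circle_norm[OF assms that] by simp
  then show "f = \<zero>\<^bsub>circle_algebra\<^esub>"
    using assms unfolding circle_algebra_simps by (intro extensionalityI[of _ "sphere 0 1"]) auto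
next
  assume "f = \<zero>\<^bsub>circle_algebra\<^esub>"
  then have "circle_norm f \<le> 0"
    by (intro circle_norm_le) (auto simp: circle_algebra_simps)
  then show "circle_norm f = 0"
    using circle_norm_nonneg[OF assms] by simp
qed

lemma circle_norm_triangle:
  assumes "f \<in> carrier circle_algebra" "g \<in> carrier circle_algebra"
  shows "circle_norm (f \<oplus>\<^bsub>circle_algebra\<^esub> g) \<le> circle_norm f + circle_norm g"
proof (rule circle_norm_le)
  fix z :: complex assume z: "z \<in> sphere 0 1"
  have "cmod (f z + g z) \<le> circle_norm f + circle_norm g"
    by (intro norm_triangle_mono norm_le_circle_norm assms z)
  then show "cmod ((f \<oplus>\<^bsub>circle_algebra\<^esub> g) z) \<le> circle_norm f + circle_norm g"
    using z by (simp add: circle_algebra_simps)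
qed

lemma circle_norm_mult:
  assumes "f \<in> carrier circle_algebra" "g \<in> carrier circle_algebra"
  shows "circle_norm (f \<otimes>\<^bsub>circle_algebra\<^esub> g) \<le> circle_norm f * circle_norm g"
proof (rule circle_norm_le)
  fix z :: complex assume z: "z \<in> sphere 0 1"
  have "cmod (f z) * cmod (g z) \<le> circle_norm f * circle_norm g"
    by (intro mult_mono norm_le_circle_norm circle_norm_nonneg assms z) auto
  then show "cmod ((f \<otimes>\<^bsub>circle_algebra\<^esub> g) z) \<le> circle_norm f * circle_norm g"
    using z by (simp add: circle_algebra_simps norm_mult)
qed

lemma circle_norm_smult_le:
  assumes "f \<in> carrier circle_algebra"
  shows "circle_norm (c \<odot>\<^bsub>circle_algebra\<^esub> f) \<le> cmod c * circle_norm f"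
  by (rule circle_norm_le)
     (auto simp: circle_algebra_simps(6) norm_mult assms intro!: mult_left_mono norm_le_circle_norm)

lemma circle_norm_smult:
  assumes f: "f \<in> carrier circle_algebra"
  shows "circle_norm (c \<odot>\<^bsub>circle_algebra\<^esub> f) = cmod c * circle_norm f"
proof (cases "c = 0")
  case True
  have "circle_norm (c \<odot>\<^bsub>circle_algebra\<^esub> f) = circle_norm \<zero>\<^bsub>circle_algebra\<^esub>"
    using True by (simp add: circle_algebra_simps)
  also have "\<dots> = 0"
    using circle_norm_eq_0[of "\<zero>\<^bsub>circle_algebra\<^esub>"] by simp
  finally show ?thesis using True by simp
next
  case False
  have cf: "c \<odot>\<^bsub>circle_algebra\<^esub> f \<in> carrier circle_algebra"
    unfolding circle_algebra_simps(6)
    by (intro to_circleI continuous_intros circle_algebraD f)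
  \<comment> \<open>The reverse inequality is the one-sided bound applied to the scalar
    \<open>inverse c\<close> and the function \<open>c\<close> times \<open>f\<close>.\<close>
  have "f = inverse c \<odot>\<^bsub>circle_algebra\<^esub> (c \<odot>\<^bsub>circle_algebra\<^esub> f)"
    using f False by (auto simp: circle_algebra_simps extensional_def fun_eq_iff)
  then have "circle_norm f \<le> cmod (inverse c) * circle_norm (c \<odot>\<^bsub>circle_algebra\<^esub> f)"
    using circle_norm_smult_le[OF cf, of "inverse c"] by simp
  then have "cmod c * circle_norm f \<le> circle_norm (c \<odot>\<^bsub>circle_algebra\<^esub> f)"
    using False by (simp add: norm_inverse norm_divide field_simps)
  then show ?thesis
    using circle_norm_smult_le[OF f, of c] by simp
qed

lemma norm_dist_circle:
  assumes "f \<in> carrier circle_algebra" "g \<in> carrier circle_algebra"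
  shows "norm_dist circle_algebra circle_norm f g = circle_norm (to_circle (\<lambda>z. f z - g z))"
  using assms by (simp add: norm_dist_def circle_minus)

lemma dist_le_norm_dist_circle:
  assumes "f \<in> carrier circle_algebra" "g \<in> carrier circle_algebra" "z \<in> sphere 0 1"
  shows "cmod (f z - g z) \<le> norm_dist circle_algebra circle_norm f g"
proof -
  have "to_circle (\<lambda>z. f z - g z) \<in> carrier circle_algebra"
    by (intro to_circleI continuous_intros circle_algebraD assms)
  then have "cmod (to_circle (\<lambda>z. f z - g z) z) \<le> norm_dist circle_algebra circle_norm f g"
    unfolding norm_dist_circle[OF assms(1,2)] by (rule norm_le_circle_norm) fact
  then show ?thesis using assms by simp
qed

lemma norm_dist_circle_le:
  assumes "f \<in> carrier circle_algebra" "g \<in> carrier circle_algebra"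
    and "\<And>z. z \<in> sphere 0 1 \<Longrightarrow> cmod (f z - g z) \<le> B"
  shows "norm_dist circle_algebra circle_norm f g \<le> B"
  unfolding norm_dist_circle[OF assms(1,2)] by (rule circle_norm_le) (simp add: assms(3))

lemma norm_dist_circle_nonneg: "0 \<le> norm_dist circle_algebra circle_norm f g"
  by (simp add: norm_dist_def circle_norm_nonneg)

interpretation circle: Metric_space "carrier circle_algebra" "norm_dist circle_algebra circle_norm"
proof
  show sym: "norm_dist circle_algebra circle_norm f g = norm_dist circle_algebra circle_norm g f" for f g
  proof (cases "f \<in> carrier circle_algebra \<and> g \<in> carrier circle_algebra")
    case True
    then show ?thesis
      by (simp add: norm_dist_circle circle_norm_def norm_minus_commute)
  qed (auto simp: norm_dist_def)
  show "norm_dist circle_algebra circle_norm f g = 0 \<longleftrightarrow> f = g"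
    if "f \<in> carrier circle_algebra" "g \<in> carrier circle_algebra" for f g
    using that unfolding norm_dist_def by (simp add: circle_norm_eq_0 circle.r_right_minus_eq)
  show "norm_dist circle_algebra circle_norm f h
      \<le> norm_dist circle_algebra circle_norm f g + norm_dist circle_algebra circle_norm g h"
    if "f \<in> carrier circle_algebra" "g \<in> carrier circle_algebra" "h \<in> carrier circle_algebra" for f g h
  proof (rule norm_dist_circle_le)
    fix z :: complex assume z: "z \<in> sphere 0 1"
    show "cmod (f z - h z) \<le> norm_dist circle_algebra circle_norm f g + norm_dist circle_algebra circle_norm g h"
      using dist_le_norm_dist_circle[OF that(1,2) z] dist_le_norm_dist_circle[OF that(2,3) z]
        norm_triangle_ineq[of "f z - g z" "g z - h z"] by simp
  qed (use that in auto)
qed (rule norm_dist_circle_nonneg)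

text \<open>Cauchy sequences for the sup norm are uniformly Cauchy on the circle, and a uniform
  limit of continuous functions is continuous.\<close>

lemma mcomplete_circle_algebra: "circle.mcomplete"
  unfolding circle.mcomplete_def
proof (intro allI impI)
  fix \<sigma> assume "circle.MCauchy \<sigma>"
  then have \<sigma>: "\<And>n. \<sigma> n \<in> carrier circle_algebra"
    and cauchy: "\<And>e. e > 0 \<Longrightarrow> \<exists>N. \<forall>m n. N \<le> m \<longrightarrow> N \<le> n \<longrightarrow> norm_dist circle_algebra circle_norm (\<sigma> m) (\<sigma> n) < e"
    unfolding circle.MCauchy_def by auto
  have "uniformly_Cauchy_on (sphere 0 1) \<sigma>"
    unfolding uniformly_Cauchy_on_def dist_norm
    by (meson \<sigma> cauchy dist_le_norm_dist_circle le_less_trans)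
  then obtain l where l: "uniform_limit (sphere 0 1) \<sigma> l sequentially"
    unfolding uniformly_convergent_eq_Cauchy[symmetric] uniformly_convergent_on_def by blast
  have "continuous_on (sphere 0 1) l"
    using l by (rule uniform_limit_theorem[rotated]) (use \<sigma> in \<open>auto simp: circle_algebra_simps\<close>)
  then have l_in: "to_circle l \<in> carrier circle_algebra"
    by (simp add: to_circle_in_circle_algebra)
  have "\<forall>\<^sub>F n in sequentially. norm_dist circle_algebra circle_norm (\<sigma> n) (to_circle l) < e" if "e > 0" for e
    using uniform_limitD[OF l half_gt_zero[OF that]]
  proof eventually_elim
    case (elim n)
    \<comment> \<open>A strict pointwise bound gives only a weak bound on the supremum; starting
      from half of \<open>e\<close> restores strictness.\<close>
    then have "norm_dist circle_algebra circle_norm (\<sigma> n) (to_circle l) \<le> e / 2"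
      by (intro norm_dist_circle_le \<sigma> l_in) (auto simp: dist_norm less_imp_le)
    with that show ?case by simp
  qed
  then show "\<exists>x. limitin circle.mtopology \<sigma> x sequentially"
    using \<sigma> l_in by (auto simp: circle.limitin_metric)
qed

lemma circle_algebra_banach_involution:
  "comm_banach_algebra_involution circle_algebra circle_norm circle_star"
proof -
  interpret Module.algebra "ring_of_type_algebra :: complex ring" circle_algebra
    by (rule algebra_circle_algebra)
  show ?thesis
  proof
    have "circle_norm \<one>\<^bsub>circle_algebra\<^esub> \<le> 1"
      by (rule circle_norm_le) (simp add: circle_algebra_simps)
    moreover have "1 \<le> circle_norm \<one>\<^bsub>circle_algebra\<^esub>"
      using norm_le_circle_norm[OF circle.one_closed, of 1] by (simp add: circle_algebra_simps)
    ultimately show "circle_norm \<one>\<^bsub>circle_algebra\<^esub> = 1" by simp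
    show "circle_star f \<in> carrier circle_algebra" if "f \<in> carrier circle_algebra" for f
      unfolding circle_star_def
      by (intro to_circleI continuous_intros circle_algebraD that)
    show "circle_star (circle_star f) = f" if "f \<in> carrier circle_algebra" for f
      using that by (auto simp: circle_star_def circle_algebra_simps extensional_def fun_eq_iff)
  qed (auto simp: circle_norm_nonneg circle_norm_eq_0 circle_norm_triangle circle_norm_smult
      circle_norm_mult mcomplete_circle_algebra, auto simp: circle_star_def circle_algebra_simps fun_eq_iff)
qed

section \<open>Semisimplicity through evaluation at points\<close>

lemma maximalideal_vanishing:
  assumes z: "z \<in> sphere 0 1"
  shows "maximalideal {f \<in> carrier circle_algebra. f z = 0} circle_algebra" (is "maximalideal ?M _")
proof (rule maximalidealI)
  show "ideal ?M circle_algebra"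
  proof (rule idealI[OF circle.ring_axioms])
    have "\<ominus>\<^bsub>circle_algebra\<^esub> f \<in> ?M" if "f \<in> ?M" for f
    proof -
      \<comment> \<open>Writing the inverse as a difference makes the pointwise formula of
        \<open>circle_minus\<close> available.\<close>
      have "\<ominus>\<^bsub>circle_algebra\<^esub> f = \<zero>\<^bsub>circle_algebra\<^esub> \<ominus>\<^bsub>circle_algebra\<^esub> f"
        using that by (simp add: circle.minus_eq)
      also have "\<dots> = to_circle (\<lambda>w. \<zero>\<^bsub>circle_algebra\<^esub> w - f w)"
        using that by (intro circle_minus) auto
      finally have "(\<ominus>\<^bsub>circle_algebra\<^esub> f) z = 0"
        using that z by (simp add: circle_algebra_simps)
      then show ?thesis using that by simp
    qed
    then show "subgroup ?M (add_monoid circle_algebra)"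
      using z by (intro circle.add.subgroupI)
        (auto intro!: exI[of _ "\<zero>\<^bsub>circle_algebra\<^esub>"] simp: a_inv_def, auto simp: circle_algebra_simps)
  qed (use z in \<open>auto, auto simp: circle_algebra_simps\<close>)
  have "\<one>\<^bsub>circle_algebra\<^esub> \<notin> ?M"
    using z by (simp add: circle_algebra_simps)
  then show "carrier circle_algebra \<noteq> ?M"
    using circle.one_closed by blast
  fix J assume J: "ideal J circle_algebra" "?M \<subseteq> J" "J \<subseteq> carrier circle_algebra"
  interpret J: ideal J circle_algebra by fact
  show "J = ?M \<or> J = carrier circle_algebra"
  proof (rule disjCI)
    assume "J \<noteq> carrier circle_algebra"
    have "f z = 0" if f: "f \<in> J" for f
    proof (rule ccontr)
      assume nz: "f z \<noteq> 0"
      have fc: "f \<in> carrier circle_algebra" using f J(3) by blast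
      \<comment> \<open>This \<open>g\<close> vanishes at \<open>z\<close>, so it lies in the
        smaller ideal, and \<open>g\<close> plus \<open>f\<close> is the nonzero constant
        \<open>f z\<close>. Thus \<open>J\<close> contains an invertible constant and is
        everything.\<close>
      define g where "g = to_circle (\<lambda>w. f z - f w)"
      have "g \<in> carrier circle_algebra"
        unfolding g_def by (intro to_circleI continuous_intros circle_algebraD fc)
      then have "g \<in> ?M"
        using z by (simp add: g_def)
      then have "g \<oplus>\<^bsub>circle_algebra\<^esub> f \<in> J"
        using J(2) f by (intro J.a_closed) auto
      moreover have "g \<oplus>\<^bsub>circle_algebra\<^esub> f = to_circle (\<lambda>_. f z)"
        by (auto simp: g_def circle_algebra_simps fun_eq_iff)
      moreover have "to_circle (\<lambda>_. inverse (f z)) \<in> carrier circle_algebra"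
        by (simp add: to_circle_in_circle_algebra)
      ultimately have "to_circle (\<lambda>_. inverse (f z)) \<otimes>\<^bsub>circle_algebra\<^esub> to_circle (\<lambda>_. f z) \<in> J"
        using J.I_l_closed by simp
      also have "to_circle (\<lambda>_. inverse (f z)) \<otimes>\<^bsub>circle_algebra\<^esub> to_circle (\<lambda>_. f z) = \<one>\<^bsub>circle_algebra\<^esub>"
        using nz by (auto simp: circle_algebra_simps fun_eq_iff)
      finally show False
        using J.one_imp_carrier \<open>J \<noteq> carrier circle_algebra\<close> by blast
    qed
    then show "J = ?M" using J by auto
  qed
qed

text \<open>The maximal ideals of functions vanishing at a point of the circle already intersect in
  zero.\<close>

lemma semisimple_circle_algebra: "semisimple circle_algebra"
  unfolding semisimple_def
proof (intro equalityI subsetI)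
  fix f assume f: "f \<in> jacobson_radical circle_algebra"
  then have "f z = 0" if "z \<in> sphere 0 1" for z
    using maximalideal_vanishing[OF that] by (auto simp: jacobson_radical_def)
  with f show "f \<in> {\<zero>\<^bsub>circle_algebra\<^esub>}"
    unfolding circle_algebra_simps jacobson_radical_def
    by (auto simp: circle_algebra_simps intro!: extensionalityI[of _ "sphere 0 1"])
next
  fix f assume "f \<in> {\<zero>\<^bsub>circle_algebra\<^esub>}"
  moreover have "\<zero>\<^bsub>circle_algebra\<^esub> \<in> M" if "maximalideal M circle_algebra" for M
    using that by (simp add: maximalideal_def ideal_def additive_subgroup.zero_closed)
  ultimately show "f \<in> jacobson_radical circle_algebra"
    by (auto simp: jacobson_radical_def)
qed

section \<open>Embedding the disk algebra by restriction to the circle\<close>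

lemma to_circle_ring_hom: "to_circle \<in> ring_hom disk_algebra circle_algebra"
  by (rule ring_hom_memI)
     (auto intro!: to_circleI elim: continuous_on_subset dest!: disk_algebraD(2),
      auto simp: circle_algebra_simps disk_algebra_simps fun_eq_iff)

text \<open>By the maximum modulus principle a difference that vanishes on the circle vanishes on
  the closed disk. This justifies identifying a function with its boundary values.\<close>

lemma to_circle_inj: "inj_on to_circle (carrier disk_algebra)"
proof (rule inj_onI)
  fix f g assume f: "f \<in> carrier disk_algebra" and g: "g \<in> carrier disk_algebra"
    and eq: "to_circle f = to_circle g"
  have "cmod (f z - g z) \<le> 0" if "z \<in> cball 0 1" for z
  proof (rule maximum_modulus_frontier[of "\<lambda>z. f z - g z" "cball 0 1"])
    show "cmod (f z - g z) \<le> 0" if "z \<in> frontier (cball 0 1)" for z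
      using fun_cong[OF eq, of z] that by simp
  qed (use f g that in \<open>auto simp: disk_algebra_simps intro!: continuous_intros holomorphic_intros\<close>)
  then show "f = g"
    using f g by (intro extensionalityI[of _ "cball 0 1"]) (auto simp: disk_algebra_simps)
qed



section \<open>The winding number\<close>

text \<open>The sum of continuous arguments of the factors is a continuous argument of the
  product.\<close>

lemma circle_winding_mult:
  assumes "f \<in> Units circle_algebra" "g \<in> Units circle_algebra"
  shows "circle_winding (f \<otimes>\<^bsub>circle_algebra\<^esub> g) = circle_winding f + circle_winding g"
proof -
  obtain \<Theta> \<Phi> where \<Theta>: "continuous_argument f \<Theta>" and \<Phi>: "continuous_argument g \<Phi>"
    using assms continuous_argument_exists by meson
  have "continuous_argument (f \<otimes>\<^bsub>circle_algebra\<^esub> g) (\<lambda>t. \<Theta> t + \<Phi> t)"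
    unfolding continuous_argument_def
  proof (intro conjI ballI)
    show "continuous_on {0..2 * pi} (\<lambda>t. \<Theta> t + \<Phi> t)"
      using \<Theta> \<Phi> by (auto simp: continuous_argument_def intro!: continuous_intros)
    fix t assume t: "t \<in> {0..2 * pi}"
    have "f (cis t) = cmod (f (cis t)) * cis (\<Theta> t)" "g (cis t) = cmod (g (cis t)) * cis (\<Phi> t)"
      using \<Theta> \<Phi> t by (auto simp: continuous_argument_def)
    then have "f (cis t) * g (cis t) =
        (cmod (f (cis t)) * cis (\<Theta> t)) * (cmod (g (cis t)) * cis (\<Phi> t))"
      by metis
    then show "(f \<otimes>\<^bsub>circle_algebra\<^esub> g) (cis t) =
        complex_of_real (cmod ((f \<otimes>\<^bsub>circle_algebra\<^esub> g) (cis t))) * cis (\<Theta> t + \<Phi> t)"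
      by (simp add: circle_algebra_simps norm_mult cis_mult[symmetric] mult_ac)
  qed
  then have "real_of_int (circle_winding (f \<otimes>\<^bsub>circle_algebra\<^esub> g)) =
      real_of_int (circle_winding f + circle_winding g)"
    using assms \<Theta> \<Phi> by (simp add: circle_winding_eq field_simps)
  then show ?thesis by linarith
qed

text \<open>Conjugation keeps the modulus and negates the argument.\<close>

lemma circle_winding_star:
  assumes "f \<in> Units circle_algebra"
  shows "circle_winding (circle_star f) = - circle_winding f"
proof -
  obtain \<Theta> where \<Theta>: "continuous_argument f \<Theta>"
    using assms continuous_argument_exists by meson
  have "continuous_argument (circle_star f) (\<lambda>t. - \<Theta> t)"
    unfolding continuous_argument_def
  proof (intro conjI ballI)
    show "continuous_on {0..2 * pi} (\<lambda>t. - \<Theta> t)"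
      using \<Theta> by (auto simp: continuous_argument_def intro!: continuous_intros)
    fix t assume t: "t \<in> {0..2 * pi}"
    have "f (cis t) = cmod (f (cis t)) * cis (\<Theta> t)"
      using \<Theta> t by (auto simp: continuous_argument_def)
    then have "cnj (f (cis t)) = cnj (cmod (f (cis t)) * cis (\<Theta> t))"
      by metis
    then have "cnj (f (cis t)) = cmod (f (cis t)) * cis (- \<Theta> t)"
      by (simp add: cis_cnj)
    moreover have "circle_star f (cis t) = cnj (f (cis t))"
      by (simp add: circle_star_def)
    ultimately show "circle_star f (cis t) = complex_of_real (cmod (circle_star f (cis t))) * cis (- \<Theta> t)"
      by (metis complex_mod_cnj)
  qed
  moreover have "circle_star f \<in> Units circle_algebra"
    unfolding circle_star_def to_circle_Units
    using Units_circle_algebraD[OF assms] by (auto intro!: continuous_intros)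
  ultimately have "real_of_int (circle_winding (circle_star f)) = real_of_int (- circle_winding f)"
    using assms \<Theta> by (simp add: circle_winding_eq field_simps)
  then show ?thesis by linarith
qed

lemma to_circle_mult: "to_circle (\<lambda>z. f z * g z) = to_circle f \<otimes>\<^bsub>circle_algebra\<^esub> to_circle g"
  by (auto simp: circle_algebra_simps fun_eq_iff)

text \<open>The imaginary part of the logarithm \<open>g\<close> along the circle is a continuous
  argument of \<open>f\<close>. As \<open>g\<close> is a function on the circle itself, this
  argument has equal values at 0 and \<open>2 * pi\<close>.\<close>

lemma circle_winding_exp:
  assumes f: "f \<in> Units circle_algebra" and g: "continuous_on (sphere 0 1) g"
    and fg: "\<And>z. z \<in> sphere 0 1 \<Longrightarrow> f z = exp (g z)"
  shows "circle_winding f = 0"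
proof -
  have "continuous_argument f (\<lambda>t. Im (g (cis t)))"
    unfolding continuous_argument_def
  proof (intro conjI ballI)
    show "continuous_on {0..2 * pi} (\<lambda>t. Im (g (cis t)))"
      by (intro continuous_intros continuous_on_compose2[OF g]) auto
    show "f (cis t) = complex_of_real (cmod (f (cis t))) * cis (Im (g (cis t)))" for t
      using fg[of "cis t"] by (simp add: exp_eq_polar norm_mult)
  qed
  from circle_winding_eq[OF f this] show ?thesis by simp
qed

text \<open>The closed disk is contractible, so \<open>f\<close> has a continuous logarithm there.
  Besides units of the disk algebra, this handles linear factors with root outside the closed disk
  and polynomials without roots.\<close>

lemma circle_winding_nonvanishing:
  assumes f: "continuous_on (cball 0 1) f" and nz: "\<And>z. z \<in> cball 0 1 \<Longrightarrow> f z \<noteq> 0"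
  shows "circle_winding (to_circle f) = 0"
proof -
  obtain g where g: "continuous_on (cball 0 1) g" "\<And>z. z \<in> cball 0 1 \<Longrightarrow> f z = exp (g z)"
    using continuous_logarithm_on_contractible[OF f convex_imp_contractible[OF convex_cball] nz] by blast
  have sub: "sphere 0 1 \<subseteq> cball (0::complex) 1" by auto
  show ?thesis
  proof (rule circle_winding_exp)
    show "to_circle f \<in> Units circle_algebra"
      unfolding to_circle_Units using continuous_on_subset[OF f sub] nz by auto
    show "continuous_on (sphere 0 1) g"
      by (rule continuous_on_subset[OF g(1) sub])
  qed (use g in auto)
qed

text \<open>This is the principle behind Rouche's theorem: the quotient of \<open>g\<close> by
  \<open>f\<close> stays within distance less than 1 of the point 1, hence in the right half-plane,
  where the principal logarithm is continuous. So the quotient has winding number 0, and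
  multiplicativity finishes.\<close>

lemma circle_winding_perturb:
  assumes f: "f \<in> Units circle_algebra" and g: "g \<in> carrier circle_algebra"
    and close: "\<And>z. z \<in> sphere 0 1 \<Longrightarrow> cmod (g z - f z) < cmod (f z)"
  shows "g \<in> Units circle_algebra" "circle_winding g = circle_winding f"
proof -
  show gU: "g \<in> Units circle_algebra"
    unfolding Units_circle_algebra using g close by fastforce
  have fz: "f z \<noteq> 0" if "z \<in> sphere 0 1" for z
    using Units_circle_algebraD(2)[OF f that] .
  define q where "q = (\<lambda>z. g z / f z)"
  have Re_q: "Re (q z) > 0" if z: "z \<in> sphere 0 1" for z
  proof -
    have "cmod (q z - 1) = cmod (g z - f z) / cmod (f z)"
      using fz[OF z] by (simp add: q_def norm_divide[symmetric] diff_divide_distrib)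
    also have "\<dots> < 1"
      using close[OF z] fz[OF z] by simp
    finally have "\<bar>Re (q z - 1)\<bar> < 1"
      using abs_Re_le_cmod[of "q z - 1"] by linarith
    then show ?thesis by simp
  qed
  have cont: "continuous_on (sphere 0 1) q"
    unfolding q_def using fz Units_circle_algebraD(1)[OF f] circle_algebraD(2)[OF g]
    by (intro continuous_intros) auto
  have nonpos: "q z \<notin> \<real>\<^sub>\<le>\<^sub>0" if "z \<in> sphere 0 1" for z
    using Re_q[OF that] by (auto simp: complex_nonpos_Reals_iff)
  have qU: "to_circle q \<in> Units circle_algebra"
    unfolding to_circle_Units using cont Re_q by fastforce
  have "circle_winding (to_circle q) = 0"
  proof (rule circle_winding_exp[OF qU])
    show "continuous_on (sphere 0 1) (\<lambda>z. Ln (q z))"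
      using cont nonpos by (intro continuous_intros) auto
    show "to_circle q z = exp (Ln (q z))" if "z \<in> sphere 0 1" for z
      using that Re_q[OF that] by (subst exp_Ln) auto
  qed
  \<comment> \<open>Off the circle both sides are \<open>undefined\<close>, since \<open>g\<close>
    is extensional.\<close>
  moreover have "g = f \<otimes>\<^bsub>circle_algebra\<^esub> to_circle q"
    using circle_algebraD(1)[OF g] fz
    by (auto simp: circle_algebra_simps fun_eq_iff q_def extensional_def)
  ultimately show "circle_winding g = circle_winding f"
    using circle_winding_mult[OF f qU] by simp
qed

section \<open>Winding numbers of polynomials\<close>

lemma circle_winding_ident: "circle_winding (to_circle (\<lambda>z. z)) = 1"
proof -
  have "continuous_argument (to_circle (\<lambda>z. z)) (\<lambda>t. t)"
    by (simp add: continuous_argument_def)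
  moreover have "to_circle (\<lambda>z. z) \<in> Units circle_algebra"
    unfolding to_circle_Units by auto
  ultimately have "real_of_int (circle_winding (to_circle (\<lambda>z. z))) = 1"
    by (simp add: circle_winding_eq)
  then show ?thesis by simp
qed

text \<open>On the circle, \<open>z - a\<close> differs from \<open>z\<close> by less than 1, the
  modulus of \<open>z\<close>, so it is a small perturbation of the identity.\<close>

lemma circle_winding_linear:
  assumes "cmod a < 1"
  shows "circle_winding (to_circle (\<lambda>z. z - a)) = 1"
proof -
  have "circle_winding (to_circle (\<lambda>z. z - a)) = circle_winding (to_circle (\<lambda>z. z))"
    using assms
    by (intro circle_winding_perturb(2)) (auto simp: to_circle_Units intro!: to_circleI continuous_intros)
  then show ?thesis by (simp add: circle_winding_ident)
qed

lemma circle_winding_poly_factor: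
  fixes q :: "complex poly"
  assumes nz: "\<And>z. z \<in> sphere 0 1 \<Longrightarrow> poly ([:- a, 1:] * q) z \<noteq> 0"
  shows "circle_winding (to_circle (poly ([:- a, 1:] * q))) =
    circle_winding (to_circle (\<lambda>z. z - a)) + circle_winding (to_circle (poly q))"
proof -
  have "poly ([:- a, 1:] * q) = (\<lambda>z. (z - a) * poly q z)"
    by (auto simp: fun_eq_iff algebra_simps)
  moreover have "to_circle (\<lambda>z. z - a) \<in> Units circle_algebra" "to_circle (poly q) \<in> Units circle_algebra"
    unfolding to_circle_Units using nz by (auto intro!: continuous_intros)
  ultimately show ?thesis
    by (simp only: to_circle_mult circle_winding_mult)
qed

text \<open>Induction on the degree, splitting off an arbitrary complex root: its linear factor
  contributes 1 if the root is inside the disk and 0 if it is outside.\<close>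

lemma circle_winding_poly_nonneg:
  fixes p :: "complex poly"
  assumes "\<And>z. z \<in> sphere 0 1 \<Longrightarrow> poly p z \<noteq> 0"
  shows "0 \<le> circle_winding (to_circle (poly p))"
  using assms
proof (induction "Polynomial.degree p" arbitrary: p rule: less_induct)
  case less
  show ?case
  proof (cases "\<exists>a. poly p a = 0")
    case False
    then have "circle_winding (to_circle (poly p)) = 0"
      by (intro circle_winding_nonvanishing continuous_intros) auto
    then show ?thesis by simp
  next
    case True
    then obtain a where "poly p a = 0" by blast
    then obtain q where p: "p = [:- a, 1:] * q"
      by (metis dvdE poly_eq_0_iff_dvd)
    have nz: "z \<noteq> a" "poly q z \<noteq> 0" if "z \<in> sphere 0 1" for z
      using less.prems[OF that] by (auto simp: p)
    \<comment> \<open>The degree of a product is the sum of the degrees only for nonzero factors;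
      \<open>q\<close> is nonzero because it does not vanish at the point 1 of the circle.\<close>
    have "q \<noteq> 0"
      using nz(2)[of 1] by auto
    then have "Polynomial.degree q < Polynomial.degree p"
      by (simp add: p Polynomial.degree_mult_eq del: mult_pCons_left)
    then have q: "0 \<le> circle_winding (to_circle (poly q))"
      using nz(2) by (rule less.hyps)
    have "circle_winding (to_circle (\<lambda>z. z - a)) \<ge> 0"
    proof (cases "cmod a < 1")
      case True
      then show ?thesis by (simp add: circle_winding_linear)
    next
      case False
      \<comment> \<open>No root lies on the circle, so a root not in the open disk is outside the
        closed disk.\<close>
      with nz(1)[of a] have "a \<notin> cball 0 1" by auto
      then have "circle_winding (to_circle (\<lambda>z. z - a)) = 0"
        by (intro circle_winding_nonvanishing continuous_intros) auto
      then show ?thesis by simp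
    qed
    with q show ?thesis
      using circle_winding_poly_factor less.prems unfolding p by simp
  qed
qed

text \<open>The factor belonging to \<open>a\<close> contributes 1, and the cofactor contributes a
  nonnegative amount.\<close>

lemma circle_winding_poly_root:
  fixes p :: "complex poly"
  assumes nz: "\<And>z. z \<in> sphere 0 1 \<Longrightarrow> poly p z \<noteq> 0" and a: "poly p a = 0" "cmod a < 1"
  shows "1 \<le> circle_winding (to_circle (poly p))"
proof -
  obtain q where p: "p = [:- a, 1:] * q"
    using a by (metis dvdE poly_eq_0_iff_dvd)
  have "poly q z \<noteq> 0" if "z \<in> sphere 0 1" for z
    using nz[OF that] by (auto simp: p)
  then show ?thesis
    using circle_winding_poly_factor[of a q] circle_winding_poly_nonneg[of q] nz a
    unfolding p by (simp only: circle_winding_linear) simp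
qed

section \<open>Polynomial approximation and zeros in the open disk\<close>

text \<open>The Taylor series of \<open>f\<close> need not converge uniformly up to the boundary, so
  \<open>f\<close> is first dilated: \<open>f (r * z)\<close> is uniformly close to
  \<open>f z\<close> by uniform continuity, and the Taylor series converges uniformly on the disk of
  radius \<open>r < 1\<close>.\<close>

lemma disk_algebra_poly_approx:
  assumes f: "f \<in> carrier disk_algebra" and "e > 0"
  obtains p :: "complex poly" where "\<And>z. z \<in> cball 0 1 \<Longrightarrow> cmod (poly p z - f z) < e"
proof -
  have "uniformly_continuous_on (cball 0 1) f"
    by (intro compact_uniformly_continuous disk_algebraD f compact_cball)
  then obtain d where d: "d > 0"
    and d': "\<And>z w. \<lbrakk>z \<in> cball 0 1; w \<in> cball 0 1; dist w z < d\<rbrakk> \<Longrightarrow> dist (f w) (f z) < e / 2"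
    unfolding uniformly_continuous_on_def using \<open>e > 0\<close> by (metis half_gt_zero)
  \<comment> \<open>The second term keeps \<open>1 - r\<close> below \<open>d\<close>; the first
    keeps \<open>r\<close> positive when \<open>d\<close> is large.\<close>
  define r where "r = max (1/2) (1 - d / 2)"
  have r: "0 < r" "r < 1" "1 - r < d"
    using d by (auto simp: r_def)
  define c where "c = (\<lambda>n. (deriv ^^ n) f 0 / fact n)"
  have sums: "(\<lambda>n. c n * z ^ n) sums f z" if "z \<in> ball 0 1" for z
    using holomorphic_power_series[OF disk_algebraD(3)[OF f] that] by (simp add: c_def)
  \<comment> \<open>The Taylor series converges at every real point between 0 and 1, which bounds
    the radius of convergence from below.\<close>
  have "1 \<le> conv_radius c"
  proof (rule conv_radius_geI_ex)
    fix \<rho> :: real assume \<rho>: "0 < \<rho>" "ereal \<rho> < 1"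
    then have "summable (\<lambda>n. c n * of_real \<rho> ^ n)"
      by (intro sums_summable[OF sums]) auto
    with \<rho> show "\<exists>z. cmod z = \<rho> \<and> summable (\<lambda>n. c n * z ^ n)"
      by (intro exI[of _ "of_real \<rho>"]) auto
  qed
  then have "ereal r < conv_radius c"
    using r by (meson ereal_less(3) le_less_trans less_le_trans ereal_less_eq(3) less_ereal.simps(1) one_ereal_def)
  from powser_uniform_limit[OF this, of 0]
  have "\<forall>\<^sub>F n in sequentially. \<forall>z\<in>cball 0 r. dist (\<Sum>i<n. c i * (z - 0) ^ i) (\<Sum>i. c i * (z - 0) ^ i) < e / 2"
    using \<open>e > 0\<close> by (intro uniform_limitD) auto
  then obtain n where n: "\<And>z. z \<in> cball 0 r \<Longrightarrow> dist (\<Sum>i<n. c i * z ^ i) (\<Sum>i. c i * z ^ i) < e / 2"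
    unfolding eventually_sequentially diff_0_right by blast
  \<comment> \<open>The Taylor polynomial evaluated at \<open>r * z\<close>, with the powers of
    \<open>r\<close> absorbed into the coefficients.\<close>
  define p where "p = (\<Sum>i<n. Polynomial.monom (c i * of_real r ^ i) i)"
  show ?thesis
  proof (rule that)
    fix z :: complex assume z: "z \<in> cball 0 1"
    have "cmod (of_real r * z) \<le> r"
      using z r mult_left_le[of "cmod z" r] by (auto simp: norm_mult)
    then have rz: "of_real r * z \<in> cball 0 r" "of_real r * z \<in> ball 0 1"
      using r by auto
    have "poly p z = (\<Sum>i<n. c i * (of_real r * z) ^ i)"
      by (simp add: p_def poly_sum poly_monom power_mult_distrib mult_ac)
    then have 1: "dist (poly p z) (f (of_real r * z)) < e / 2"
      using n[OF rz(1)] sums_unique[OF sums[OF rz(2)]] by simp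
    have "dist (of_real r * z) z = cmod (of_real (r - 1) * z)"
      by (simp add: dist_norm algebra_simps)
    also have "\<dots> = (1 - r) * cmod z"
      using r by (simp add: norm_mult del: of_real_diff)
    also have "\<dots> \<le> 1 - r"
      using z r by (intro mult_left_le) auto
    also have "\<dots> < d"
      by (rule r(3))
    finally have 2: "dist (f (of_real r * z)) (f z) < e / 2"
      using z rz(2) by (intro d') auto
    show "cmod (poly p z - f z) < e"
      using dist_triangle[of "poly p z" "f z" "f (of_real r * z)"] 1 2 by (simp add: dist_norm)
  qed
qed

lemma circle_winding_root:
  assumes f: "f \<in> carrier disk_algebra" and nz: "\<And>z. z \<in> sphere 0 1 \<Longrightarrow> f z \<noteq> 0"
    and a: "a \<in> ball 0 1" "f a = 0"
  shows "1 \<le> circle_winding (to_circle f)"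
proof -
  have cont: "continuous_on (sphere 0 1) f"
    by (rule continuous_on_subset[OF disk_algebraD(2)[OF f]]) auto
  then have "continuous_on (sphere 0 1) (\<lambda>z. cmod (f z))"
    by (intro continuous_intros)
  then obtain w where w: "w \<in> sphere 0 1" "\<And>z. z \<in> sphere 0 1 \<Longrightarrow> cmod (f w) \<le> cmod (f z)"
    using continuous_attains_inf[of "sphere (0::complex) 1" "\<lambda>z. cmod (f z)"] by auto
  \<comment> \<open>Half the minimum of the modulus of \<open>f\<close> on the circle, because the
    error is spent twice: on \<open>p\<close> against \<open>f\<close> at \<open>z\<close>, and on
    the constant \<open>poly p a\<close>, which is itself an approximation error as
    \<open>f a = 0\<close>.\<close>
  obtain p where p: "\<And>z. z \<in> cball 0 1 \<Longrightarrow> cmod (poly p z - f z) < cmod (f w) / 2"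
    using disk_algebra_poly_approx[OF f, of "cmod (f w) / 2"] nz[OF w(1)] by auto
  define q where "q = p - [:poly p a:]"
  have close: "cmod (poly q z - f z) < cmod (f z)" if z: "z \<in> sphere 0 1" for z
  proof -
    have "cmod (poly p a) < cmod (f w) / 2"
      using p[of a] a by simp
    moreover have "cmod (poly p z - f z) < cmod (f w) / 2"
      using p[of z] z by simp
    moreover have "cmod (poly q z - f z) \<le> cmod (poly p z - f z) + cmod (poly p a)"
      using norm_triangle_ineq4[of "poly p z - f z" "poly p a"] by (simp add: q_def algebra_simps)
    ultimately show ?thesis
      using w(2)[OF z] by linarith
  qed
  have "circle_winding (to_circle (poly q)) = circle_winding (to_circle f)"
    using close nz cont
    by (intro circle_winding_perturb(2)) (auto simp: to_circle_Units intro!: to_circleI continuous_intros)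
  moreover have "poly q z \<noteq> 0" if "z \<in> sphere 0 1" for z
    using close[OF that] by auto
  then have "1 \<le> circle_winding (to_circle (poly q))"
    using a by (intro circle_winding_poly_root[of q a]) (auto simp: q_def)
  ultimately show ?thesis by simp
qed

text \<open>The invertibility criterion for the whole disk algebra; a full subring inherits it,
  since its units are exactly its elements invertible in the disk algebra.\<close>

lemma Units_disk_algebra_iff_winding:
  assumes f: "f \<in> carrier disk_algebra" and U: "to_circle f \<in> Units circle_algebra"
  shows "f \<in> Units disk_algebra \<longleftrightarrow> circle_winding (to_circle f) = 0"
proof
  assume "f \<in> Units disk_algebra"
  then show "circle_winding (to_circle f) = 0"
    by (intro circle_winding_nonvanishing disk_algebraD f) (auto simp: Units_disk_algebra)
next
  assume 0: "circle_winding (to_circle f) = 0"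
  have nz: "f z \<noteq> 0" if "z \<in> sphere 0 1" for z
    using U that by (auto simp: to_circle_Units)
  have "f z \<noteq> 0" if "z \<in> cball 0 1" for z
  proof (cases "z \<in> sphere 0 1")
    case False
    with that have "z \<in> ball 0 1" by auto
    \<comment> \<open>A zero in the open disk would force winding number at least 1.\<close>
    with circle_winding_root[OF f nz] 0 show ?thesis by fastforce
  qed (rule nz)
  with f show "f \<in> Units disk_algebra"
    by (auto simp: Units_disk_algebra)
qed

text \<open>Around each unit the winding number is constant on a ball, so the preimage of any set of
  integers is a neighbourhood of each of its points.\<close>

lemma circle_winding_locally_constant:
  "continuous_map
     (subtopology (norm_topology circle_algebra circle_norm) (Units circle_algebra))
     (discrete_topology (UNIV :: int set)) circle_winding"
  unfolding continuous_map
proof (intro conjI allI impI)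
  fix V :: "int set"
  let ?S = "subtopology circle.mtopology (Units circle_algebra)"
  let ?U = "{f \<in> topspace ?S. circle_winding f \<in> V}"
  have UC: "Units circle_algebra \<subseteq> carrier circle_algebra"
    by (auto simp: Units_def)
  then have top: "topspace ?S = Units circle_algebra"
    by auto
  show "openin ?S ?U"
  proof (subst openin_subopen, intro ballI)
    fix f assume f: "f \<in> ?U"
    then have fU: "f \<in> Units circle_algebra" and fC: "f \<in> carrier circle_algebra"
      using top UC by auto
    have "continuous_on (sphere 0 1) (\<lambda>z. cmod (f z))"
      by (intro continuous_intros circle_algebraD fC)
    then obtain w where w: "w \<in> sphere 0 1" "\<And>z. z \<in> sphere 0 1 \<Longrightarrow> cmod (f w) \<le> cmod (f z)"
      using continuous_attains_inf[of "sphere (0::complex) 1" "\<lambda>z. cmod (f z)"] by auto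
    have pos: "0 < cmod (f w)"
      using Units_circle_algebraD(2)[OF fU w(1)] by simp
    \<comment> \<open>With the minimum of the modulus of \<open>f\<close> on the circle as radius,
      every \<open>g\<close> in the ball is pointwise closer to \<open>f\<close> than the modulus of
      \<open>f\<close>, as \<open>circle_winding_perturb\<close> requires.\<close>
    let ?B = "Units circle_algebra \<inter> circle.mball f (cmod (f w))"
    have "g \<in> ?U" if g: "g \<in> ?B" for g
    proof -
      have gC: "g \<in> carrier circle_algebra"
        and "norm_dist circle_algebra circle_norm g f < cmod (f w)"
        using g by (auto simp: circle.commute)
      then have "cmod (g z - f z) < cmod (f z)" if "z \<in> sphere 0 1" for z
        using dist_le_norm_dist_circle[OF gC fC that] w(2)[OF that] by linarith
      from circle_winding_perturb(2)[OF fU gC this] show ?thesis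
        using f g top by auto
    qed
    then have "?B \<subseteq> ?U" by blast
    moreover have "openin ?S ?B"
      by (intro openin_subtopology_Int2 circle.openin_mball)
    moreover have "f \<in> ?B"
      using fU fC pos by simp
    ultimately show "\<exists>T. openin ?S T \<and> f \<in> T \<and> T \<subseteq> ?U"
      by blast
  qed
qed auto

theorem lemma5p2:
  fixes R :: "(complex \<Rightarrow> complex) set"
  assumes "full_subring R disk_algebra"
  shows
    \<comment> \<open>(A1)\<close>
    "domain (disk_algebra\<lparr>carrier := R\<rparr>) \<and>
    \<comment> \<open>(A2)\<close>
     comm_banach_algebra_involution circle_algebra circle_norm circle_star \<and>
     semisimple circle_algebra \<and>
     to_circle \<in> ring_hom (disk_algebra\<lparr>carrier := R\<rparr>) circle_algebra \<and>
     inj_on to_circle R \<and>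
    \<comment> \<open>(A3)\<close>
     (\<forall>a \<in> Units circle_algebra. \<forall>b \<in> Units circle_algebra.
        circle_winding (a \<otimes>\<^bsub>circle_algebra\<^esub> b) = circle_winding a + circle_winding b) \<and>
     (\<forall>a \<in> Units circle_algebra. circle_winding (circle_star a) = - circle_winding a) \<and>
     continuous_map
       (subtopology (norm_topology circle_algebra circle_norm) (Units circle_algebra))
       (discrete_topology (UNIV :: int set)) circle_winding \<and>
    \<comment> \<open>(A4)\<close>
     (\<forall>x \<in> R. to_circle x \<in> Units circle_algebra \<longrightarrow>
        (x \<in> Units (disk_algebra\<lparr>carrier := R\<rparr>) \<longleftrightarrow> circle_winding (to_circle x) = 0))"
proof -
  interpret disk: "domain" disk_algebra
    by (rule domain_disk_algebra)
  have sub: "subring R disk_algebra"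
    and full: "\<And>x. x \<in> R \<Longrightarrow> x \<in> Units disk_algebra \<Longrightarrow> x \<in> Units (disk_algebra\<lparr>carrier := R\<rparr>)"
    using assms by (auto simp: full_subring_def)
  have R: "R \<subseteq> carrier disk_algebra"
    by (rule subringE(1)[OF sub])
  \<comment> \<open>One direction is fullness; for the other, an inverse in \<open>R\<close> is also
    an inverse in the disk algebra, as the operations agree.\<close>
  have units: "x \<in> Units (disk_algebra\<lparr>carrier := R\<rparr>) \<longleftrightarrow> x \<in> Units disk_algebra" if "x \<in> R" for x
    using full[OF that] R by (auto simp: Units_def)
  have hom: "to_circle \<in> ring_hom (disk_algebra\<lparr>carrier := R\<rparr>) circle_algebra"
    using to_circle_ring_hom R by (auto simp: ring_hom_def Pi_iff subset_iff)
  show ?thesis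
    using disk.subring_is_domain[OF sub] circle_algebra_banach_involution semisimple_circle_algebra hom
      inj_on_subset[OF to_circle_inj R] circle_winding_mult circle_winding_star
      circle_winding_locally_constant units Units_disk_algebra_iff_winding R
    by blast
qed

end
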